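(* There exist a bounded simply connected domain $\Omega\subset\mathbb{C}$ and functions $f_1,f_2$, holomorphic on $\Omega$ and continuous on $\overline{\Omega}$, with $f_2$ not identically zero, such that $$f_1(\zeta)=\overline{\zeta}\,f_2(\zeta)\qquad\text{for all }\zeta\in\partial\Omega,$$ and such that $\partial\Omega$ is a $C^\infty$-smooth curve that is not real analytic. *)

theory Defs
  imports "HOL-Complex_Analysis.Complex_Analysis"
begin

definition smooth_param :: "(real \<Rightarrow> complex) \<Rightarrow> bool" where
  "smooth_param \<gamma> \<longleftrightarrow>
     (\<forall>n t. ((\<lambda>g s. vector_derivative g (at s)) ^^ n) \<gamma> differentiable (at t))"

definition real_analytic_param :: "(real \<Rightarrow> complex) \<Rightarrow> bool" where
  "real_analytic_param \<gamma> \<longleftrightarrow>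
     (\<forall>t. \<exists>r>0. \<exists>a :: nat \<Rightarrow> complex.
        \<forall>s. \<bar>s - t\<bar> < r \<longrightarrow> (\<lambda>n. a n * of_real (s - t) ^ n) sums \<gamma> s)"

text \<open>Closed parametrizations are 1-periodic functions on the whole real line, so that the
  regularity imposed on them also holds where the ends of \<open>{0..1}\<close> are glued together. The
  condition on the derivative excludes parametrizations that slow down to pass a corner or cusp.\<close>

definition regular_jordan_param :: "(real \<Rightarrow> complex) \<Rightarrow> complex set \<Rightarrow> bool" where
  "regular_jordan_param \<gamma> S \<longleftrightarrow>
     simple_path \<gamma> \<and> path_image \<gamma> = S \<and>
     (\<forall>t. \<gamma> (t + 1) = \<gamma> t) \<and>
     (\<forall>t. \<gamma> differentiable (at t) \<and> vector_derivative \<gamma> (at t) \<noteq> 0)"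

text \<open>Smoothness and analyticity are properties of the curve as a set: some
  parametrization has the property.\<close>

definition smooth_jordan_curve :: "complex set \<Rightarrow> bool" where
  "smooth_jordan_curve S \<longleftrightarrow> (\<exists>\<gamma>. regular_jordan_param \<gamma> S \<and> smooth_param \<gamma>)"

definition real_analytic_jordan_curve :: "complex set \<Rightarrow> bool" where
  "real_analytic_jordan_curve S \<longleftrightarrow> (\<exists>\<gamma>. regular_jordan_param \<gamma> S \<and> real_analytic_param \<gamma>)"

end

theory Submission
  imports Defs
begin

text \<open>Let \<open>\<Omega>\<close> be the image of the unit disc under \<open>\<phi>(z) = z + \<epsilon> / cosh s\<close> with
  \<open>s = (1 - z)\<^bsup>-1/2\<^esup>\<close> and small \<open>\<epsilon> > 0\<close>. On the closed disc \<open>s\<close> lies in the sector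
  \<open>\<bar>Im s\<bar> \<le> Re s\<close>, where \<open>1 / cosh s\<close> decays like \<open>exp (- Re s)\<close>; so the perturbation is flat at
  \<open>z = 1\<close> and the boundary of \<open>\<Omega>\<close> is smooth. As \<open>cosh\<close> is even, \<open>1 / cosh s\<close> is meromorphic in
  \<open>\<complex> - {1}\<close>, hence on the circle \<open>cnj \<phi>\<close> has a meromorphic continuation into the disc, with poles
  accumulating at \<open>1\<close>. It is a quotient of two functions holomorphic in the disc, which a common
  factor \<open>exp (- 4 s)\<close> makes continuous at \<open>1\<close>; composing them with the inverse of \<open>\<phi>\<close> gives
  \<open>f\<^sub>1\<close> and \<open>f\<^sub>2\<close>.

  If the boundary had an analytic parametrization \<open>\<gamma>\<close>, then \<open>\<bar>\<gamma>\<bar>\<^sup>2 - 1\<close> would be analytic and flat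
  at the parameter of the point \<open>\<phi>(1) = 1\<close>, hence \<open>\<bar>\<phi>\<bar> = 1\<close> on an arc of the circle ending at \<open>1\<close>.
  But there are points of the circle on both sides of \<open>1\<close>, arbitrarily close to it, where
  \<open>\<bar>\<phi>\<bar> > 1\<close>.\<close>

subsection \<open>The hyperbolic cosine on a sector\<close>

lemma Re_cosh: "Re (cosh s) = cosh (Re s) * cos (Im s)"
  and Im_cosh: "Im (cosh s) = sinh (Re s) * sin (Im s)"
  by (simp_all add: cosh_def sinh_def Re_exp Im_exp field_simps)

lemma cmod_cosh_power2: "(cmod (cosh s))\<^sup>2 = (sinh (Re s))\<^sup>2 + (cos (Im s))\<^sup>2"
proof -
  have "(cmod (cosh s))\<^sup>2 = (cosh (Re s))\<^sup>2 * (cos (Im s))\<^sup>2 + (sinh (Re s))\<^sup>2 * (sin (Im s))\<^sup>2"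
    by (simp add: cmod_power2 Re_cosh Im_cosh power_mult_distrib)
  also have "\<dots> = (sinh (Re s))\<^sup>2 + (cos (Im s))\<^sup>2"
    unfolding cosh_square_eq[of "Re s"] sin_squared_eq by algebra
  finally show ?thesis .
qed

lemma sinh_ge_self: "x \<le> sinh x" if "0 \<le> x" for x :: real
proof -
  have "sinh 0 - 0 \<le> sinh x - x"
  proof (rule DERIV_nonneg_imp_nondecreasing[OF that])
    show "\<exists>y. ((\<lambda>x. sinh x - x) has_real_derivative y) (at t) \<and> 0 \<le> y" for t :: real
      by (rule exI[of _ "cosh t - 1"]) (auto intro!: derivative_eq_intros simp: cosh_real_ge_1)
  qed
  then show ?thesis by simp
qed

text \<open>The range that matters for \<open>tau\<close>: a square root halves arguments, so the
  half plane \<open>Re z < 1\<close> lands within angle pi/4 of the positive axis, away from the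
  zeros of \<open>cosh\<close> on the imaginary axis.\<close>

definition sector :: "complex set" where
  "sector = {s. 0 < Re s \<and> \<bar>Im s\<bar> \<le> Re s}"

text \<open>On the sector |sin y| \<le> |y| \<le> x \<le> sinh x, so the loss through cos y is
  compensated by sinh x and |cosh s| stays comparable to cosh x.\<close>

lemma cmod_cosh_ge:
  assumes "s \<in> sector"
  shows "exp (Re s) / 4 \<le> cmod (cosh s)"
proof -
  define x y where "x = Re s" and "y = Im s"
  have x: "0 < x" "\<bar>y\<bar> \<le> x" using assms by (auto simp: sector_def x_def y_def)
  have "\<bar>sin y\<bar> \<le> sinh x"
    using x sinh_ge_self[of x] abs_sin_x_le_abs_x[of y] by linarith
  then have "(sin y)\<^sup>2 \<le> (sinh x)\<^sup>2" 
    by (metis abs_ge_zero power2_abs power_mono)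
  then have "1 \<le> (sinh x)\<^sup>2 + (cos y)\<^sup>2" using sin_cos_squared_add[of y] by linarith
  \<comment> \<open>The right-hand side dominates both 1 and the square of sinh x, hence half of
    their sum, which is the square of cosh x.\<close>
  then have "((cosh x)\<^sup>2) / 2 \<le> (sinh x)\<^sup>2 + (cos y)\<^sup>2"
    using cosh_square_eq[of x] by (smt (verit) zero_le_power2 field_sum_of_halves)
  also have "\<dots> = (cmod (cosh s))\<^sup>2" by (simp add: cmod_cosh_power2 x_def y_def)
  finally have "((cosh x)\<^sup>2) / 2 \<le> (cmod (cosh s))\<^sup>2" .
  moreover have "(exp x / 4)\<^sup>2 \<le> (cosh x / 2)\<^sup>2"
    by (rule power_mono) (auto simp: cosh_def field_simps)
  moreover have "(cosh x / 2)\<^sup>2 \<le> ((cosh x)\<^sup>2) / 2" by (simp add: power_divide)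
  ultimately have "(exp x / 4)\<^sup>2 \<le> (cmod (cosh s))\<^sup>2" by linarith
  then show ?thesis unfolding x_def by (rule power2_le_imp_le) simp
qed

lemma cosh_sector_nonzero: "s \<in> sector \<Longrightarrow> cosh s \<noteq> 0"
  using cmod_cosh_ge[of s] by auto

lemma cmod_sector_le: "s \<in> sector \<Longrightarrow> cmod s \<le> 2 * Re s"
  using cmod_le[of s] by (auto simp: sector_def)

lemma cmod_tanh_le: 
  assumes "s \<in> sector"
  shows "cmod (tanh s) \<le> 4"
proof -
  have "cmod (sinh s) \<le> (cmod (exp s) + cmod (exp (-s))) / 2"
    unfolding sinh_def using norm_triangle_ineq4[of "exp s" "exp (-s)"] by simp
  also have "\<dots> \<le> exp (Re s)" using assms by (simp add: sector_def)
  also have "\<dots> \<le> 4 * cmod (cosh s)" using cmod_cosh_ge[OF assms] by simp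
  finally show ?thesis using cosh_sector_nonzero[OF assms]
    by (simp add: tanh_def norm_divide field_simps)
qed

text \<open>Polynomials in \<open>s\<close> and \<open>tanh s\<close>. Since \<open>(q / cosh)' = (q' - tanh * q) / cosh\<close>, all
  derivatives of \<open>1 / cosh\<close> have the form \<open>q / cosh\<close> with tame \<open>q\<close>.\<close>

inductive tame :: "(complex \<Rightarrow> complex) \<Rightarrow> bool" where
  tame_const: "tame (\<lambda>_. c)"
| tame_id: "tame (\<lambda>s. s)"
| tame_tanh: "tame tanh"
| tame_add: "tame p \<Longrightarrow> tame q \<Longrightarrow> tame (\<lambda>s. p s + q s)"
| tame_mult: "tame p \<Longrightarrow> tame q \<Longrightarrow> tame (\<lambda>s. p s * q s)"

lemma tame_diff: 
  assumes "tame p" "tame q" shows "tame (\<lambda>s. p s - q s)"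
  using tame_add[OF assms(1) tame_mult[OF tame_const[of "-1"] assms(2)]] by simp

lemma tame_power: "tame p \<Longrightarrow> tame (\<lambda>s. p s ^ n)"
  by (induction n) (auto intro: tame.intros tame_const[of 1])

text \<open>The derivative 1 - tanh^2 of tanh is again a polynomial in tanh, so the class is closed
  under differentiation. The restriction to the sector keeps clear of the poles of tanh.\<close>

lemma tame_derivative:
  "tame q \<Longrightarrow> \<exists>q'. tame q' \<and> (\<forall>s\<in>sector. (q has_field_derivative q' s) (at s))"
proof (induction rule: tame.induct)
  case (tame_const c)
  show ?case by (rule exI[of _ "\<lambda>_. 0"]) (auto intro: tame.intros)
next
  case tame_id
  show ?case by (rule exI[of _ "\<lambda>_. 1"]) (auto intro: tame.intros)
next
  case tame_tanh
  show ?case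
    by (rule exI[of _ "\<lambda>s. 1 - tanh s ^ 2"])
      (auto intro!: tame_diff tame_power tame.intros derivative_eq_intros simp: cosh_sector_nonzero)
next
  case (tame_add p q)
  then obtain p' q' where "tame p'" "\<forall>s\<in>sector. (p has_field_derivative p' s) (at s)"
    "tame q'" "\<forall>s\<in>sector. (q has_field_derivative q' s) (at s)" by blast
  then show ?case
    by (intro exI[of _ "\<lambda>s. p' s + q' s"]) (auto intro!: tame.tame_add derivative_eq_intros)
next
  case (tame_mult p q)
  then obtain p' q' where "tame p'" "\<forall>s\<in>sector. (p has_field_derivative p' s) (at s)"
    "tame q'" "\<forall>s\<in>sector. (q has_field_derivative q' s) (at s)" by blast
  with tame_mult.hyps show ?case
    by (intro exI[of _ "\<lambda>s. p' s * q s + q' s * p s"])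
      (auto intro!: tame.tame_add tame.tame_mult derivative_eq_intros)
qed

lemma tame_polynomial_growth:
  "tame q \<Longrightarrow> \<exists>C N. 0 \<le> C \<and> (\<forall>s\<in>sector. cmod (q s) \<le> C * (1 + cmod s) ^ N)"
proof (induction rule: tame.induct)
  case (tame_const c)
  show ?case by (rule exI[of _ "cmod c"], rule exI[of _ 0]) auto
next
  case tame_id
  show ?case by (rule exI[of _ 1], rule exI[of _ 1]) auto
next
  case tame_tanh
  show ?case by (rule exI[of _ 4], rule exI[of _ 0]) (auto simp: cmod_tanh_le)
next
  case (tame_add p q)
  then obtain C N D M where 1: "0 \<le> C" "\<forall>s\<in>sector. cmod (p s) \<le> C * (1 + cmod s) ^ N"
    "0 \<le> D" "\<forall>s\<in>sector. cmod (q s) \<le> D * (1 + cmod s) ^ M" by blast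
  have "cmod (p s + q s) \<le> (C + D) * (1 + cmod s) ^ (N + M)" if s: "s \<in> sector" for s
  proof -
    have "cmod (p s + q s) \<le> C * (1 + cmod s) ^ N + D * (1 + cmod s) ^ M"
      using 1 s norm_triangle_ineq[of "p s" "q s"] by force
    also have "\<dots> \<le> C * (1 + cmod s) ^ (N + M) + D * (1 + cmod s) ^ (N + M)"
      using 1 by (intro add_mono mult_left_mono power_increasing) auto
    finally show ?thesis by (simp add: algebra_simps)
  qed
  then show ?case using 1 by (intro exI[of _ "C + D"] exI[of _ "N + M"]) auto
next
  case (tame_mult p q)
  then obtain C N D M where 1: "0 \<le> C" "\<forall>s\<in>sector. cmod (p s) \<le> C * (1 + cmod s) ^ N"
    "0 \<le> D" "\<forall>s\<in>sector. cmod (q s) \<le> D * (1 + cmod s) ^ M" by blast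
  have "cmod (p s * q s) \<le> (C * D) * (1 + cmod s) ^ (N + M)" if s: "s \<in> sector" for s
  proof -
    have "cmod (p s * q s) \<le> (C * (1 + cmod s) ^ N) * (D * (1 + cmod s) ^ M)"
      unfolding norm_mult using 1 s by (intro mult_mono) auto
    then show ?thesis by (simp add: algebra_simps power_add)
  qed
  then show ?case using 1 by (intro exI[of _ "C * D"] exI[of _ "N + M"]) auto
qed

text \<open>A tame function grows at most like a power of Re s on the sector, because |s| \<le> 2 Re
  s there, while |cosh s| grows at least like exp (Re s).\<close>

lemma tame_over_cosh_bounded:
  assumes "tame q"
  shows "\<exists>C. 0 \<le> C \<and> (\<forall>s\<in>sector. cmod (q s / cosh s) \<le> C)"
proof -
  obtain C N where 1: "0 \<le> C" "\<forall>s\<in>sector. cmod (q s) \<le> C * (1 + cmod s) ^ N"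
    using tame_polynomial_growth[OF assms] by blast
  have "((\<lambda>x. x ^ N / exp x) \<longlongrightarrow> (0::real)) at_top" by (rule tendsto_power_div_exp_0)
  then have "eventually (\<lambda>x. x ^ N / exp x < (1::real)) at_top"
    by (rule order_tendstoD) simp
  then obtain K where K: "\<And>x. x \<ge> K \<Longrightarrow> x ^ N / exp x < (1::real)"
    by (auto simp: eventually_at_top_linorder)
  \<comment> \<open>The limit controls only x \<ge> K; the summand |K|^N takes care of 0 \<le> x <
    K, where exp x \<ge> 1.\<close>
  define L where "L = \<bar>K\<bar> ^ N + 1"
  have L: "x ^ N \<le> L * exp x" if "0 \<le> x" for x :: real
  proof (cases "K \<le> x")
    case True
    then have "x ^ N \<le> 1 * exp x" using K[of x] by (simp add: field_simps)
    also have "\<dots> \<le> L * exp x" by (intro mult_right_mono) (auto simp: L_def)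
    finally show ?thesis .
  next
    case False
    then have "x ^ N \<le> \<bar>K\<bar> ^ N" using that by (intro power_mono) auto
    also have "\<dots> \<le> L * 1" by (simp add: L_def)
    also have "\<dots> \<le> L * exp x" using that by (intro mult_left_mono) (auto simp: L_def)
    finally show ?thesis .
  qed
  have "cmod (q s / cosh s) \<le> 4 * C * 2 ^ N * L * exp 1" if s: "s \<in> sector" for s
  proof -
    have r: "0 < Re s" using s by (simp add: sector_def)
    have "cmod (q s) \<le> C * (1 + cmod s) ^ N" using 1 s by auto
    also have "\<dots> \<le> C * (2 * (1 + Re s)) ^ N"
      using 1 cmod_sector_le[OF s] by (intro mult_left_mono power_mono) auto
    also have "\<dots> = C * 2 ^ N * (1 + Re s) ^ N" by (simp only: power_mult_distrib mult.assoc)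
    also have "\<dots> \<le> C * 2 ^ N * (L * exp (1 + Re s))"
      using 1 r by (intro mult_left_mono L) auto
    also have "\<dots> = (4 * C * 2 ^ N * L * exp 1) * (exp (Re s) / 4)" by (simp add: exp_add)
    also have "\<dots> \<le> (4 * C * 2 ^ N * L * exp 1) * cmod (cosh s)"
      using 1 cmod_cosh_ge[OF s] by (intro mult_left_mono) (auto simp: L_def)
    finally show ?thesis using cosh_sector_nonzero[OF s] by (simp add: norm_divide field_simps)
  qed
  moreover have "0 \<le> 4 * C * 2 ^ N * L * exp 1" using 1 by (auto simp: L_def)
  ultimately show ?thesis by blast
qed

subsection \<open>Flat functions on the disc\<close>

definition tau :: "complex \<Rightarrow> complex" where
  "tau z = inverse (csqrt (1 - z))"

lemma tau_power2: "tau z ^ 2 = inverse (1 - z)"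
  by (simp add: tau_def power_inverse)

lemma cmod_tau: "cmod (tau z) = 1 / sqrt (cmod (1 - z))"
  by (simp add: tau_def norm_inverse inverse_eq_divide norm_divide)

text \<open>For the principal root r of 1 - z, Re (r^2) > 0 means |Im r| < |Re r|, and Re r \<ge> 0.
  Inversion divides both parts by |r|^2 up to sign and so preserves this.\<close>

lemma tau_in_sector:
  assumes "Re z < 1"
  shows "tau z \<in> sector"
proof -
  define r where "r = csqrt (1 - z)"
  have "r ^ 2 = 1 - z" by (simp add: r_def)
  then have "Re (r ^ 2) > 0" using assms by simp
  then have "\<bar>Im r\<bar>\<^sup>2 < (Re r)\<^sup>2" by (simp add: power2_eq_square)
  then have a: "\<bar>Im r\<bar> < Re r" by (rule power2_less_imp_less) (unfold r_def, rule Re_csqrt)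
  then have "(Re r)\<^sup>2 + (Im r)\<^sup>2 > 0" by (metis abs_ge_zero less_le_trans order_less_irrefl sum_power2_gt_zero_iff)
  moreover have "tau z = inverse r" by (simp add: tau_def r_def)
  ultimately show ?thesis using a
    by (auto simp: sector_def abs_divide intro!: divide_right_mono divide_pos_pos)
qed

lemma has_field_derivative_tau:
  assumes "Re z < 1"
  shows "(tau has_field_derivative tau z ^ 3 / 2) (at z)"
proof -
  have nz: "1 - z \<notin> \<real>\<^sub>\<le>\<^sub>0" using assms by (auto simp: complex_nonpos_Reals_iff)
  then have "1 - z \<noteq> 0" by auto
  with nz show ?thesis unfolding tau_def
    by (auto intro!: derivative_eq_intros simp: field_simps power2_eq_square power3_eq_cube)
qed

text \<open>The point 1 needs its own case: \<open>tau 1\<close> is \<open>inverse 0 = 0\<close>, so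
  the formula would give \<open>q 0\<close> there instead of the limit 0 that holds for tame
  \<open>q\<close>.\<close>

definition flat_ext :: "(complex \<Rightarrow> complex) \<Rightarrow> complex \<Rightarrow> complex" where
  "flat_ext q z = (if z = 1 then 0 else q (tau z) / cosh (tau z))"

lemma flat_ext_1 [simp]: "flat_ext q 1 = 0"
  by (simp add: flat_ext_def)

text \<open>Dividing by |1 - z|^N is multiplying by |tau z|^(2N), and s^(2N) * q is tame along with
  q.\<close>

lemma flat_ext_flat:
  assumes "tame q"
  obtains C where "0 \<le> C" "\<And>z. Re z < 1 \<or> z = 1 \<Longrightarrow> cmod (flat_ext q z) \<le> C * cmod (1 - z) ^ N"
proof -
  have "tame (\<lambda>s. s ^ (2 * N) * q s)" by (intro tame_mult tame_power tame_id assms)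
  from tame_over_cosh_bounded[OF this] obtain C where
    C: "0 \<le> C" "\<And>s. s \<in> sector \<Longrightarrow> cmod (s ^ (2 * N) * q s / cosh s) \<le> C" by blast
  have "cmod (flat_ext q z) \<le> C * cmod (1 - z) ^ N" if z: "Re z < 1" for z
  proof -
    have nz: "z \<noteq> 1" using z by auto
    have "cmod (tau z ^ (2 * N) * q (tau z) / cosh (tau z)) \<le> C" by (rule C) (rule tau_in_sector[OF z])
    then have "cmod (q (tau z) / cosh (tau z)) * cmod (tau z ^ (2 * N)) \<le> C"
      by (simp add: norm_mult norm_divide mult_ac)
    moreover have "tau z ^ (2 * N) = inverse ((1 - z) ^ N)"
      by (simp add: power_mult tau_power2 power_inverse)
    ultimately have "cmod (q (tau z) / cosh (tau z)) * inverse (cmod (1 - z) ^ N) \<le> C"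
      by (simp only: norm_inverse norm_power)
    then show ?thesis using nz
      by (simp add: flat_ext_def divide_inverse[symmetric] pos_divide_le_eq)
  qed
  with C(1) show ?thesis by (intro that[of C]) auto
qed

text \<open>Chain rule with tau' = tau^3 / 2. The result is again a flat extension, of a tame
  function if \<open>q\<close> and \<open>p\<close> are tame, so estimates for flat extensions apply
  to derivatives too.\<close>

lemma has_field_derivative_flat_ext:
  assumes p: "\<And>s. s \<in> sector \<Longrightarrow> (q has_field_derivative p s) (at s)" and z: "Re z < 1"
  shows "(flat_ext q has_field_derivative
    flat_ext (\<lambda>s. s ^ 3 / 2 * (p s - tanh s * q s)) z) (at z)"
proof -
  define s where "s = tau z"
  have s: "s \<in> sector" unfolding s_def by (rule tau_in_sector[OF z])
  have nz: "cosh s \<noteq> 0" by (rule cosh_sector_nonzero[OF s])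
  have "z \<noteq> 1" using z by auto
  have "((\<lambda>z. q (tau z) / cosh (tau z)) has_field_derivative
      s ^ 3 / 2 * (p s - tanh s * q s) / cosh s) (at z)"
    using nz unfolding s_def
    by (auto intro!: derivative_eq_intros DERIV_chain2[OF p has_field_derivative_tau[OF z]]
         has_field_derivative_tau[OF z] simp: s s_def[symmetric])
       (simp add: tanh_def field_simps)
  moreover have "\<forall>\<^sub>F w in nhds z. q (tau w) / cosh (tau w) = flat_ext q w"
    using t1_space_nhds[OF \<open>z \<noteq> 1\<close>] by eventually_elim (simp add: flat_ext_def)
  ultimately show ?thesis using \<open>z \<noteq> 1\<close>
    by (subst (asm) DERIV_cong_ev[OF refl _ refl]) (auto simp: flat_ext_def s_def)
qed

text \<open>Two sources: inside the convex half plane the derivative is bounded; if one of the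
  points is the boundary point 1, flatness of order 1 gives the estimate directly.\<close>

lemma flat_ext_lipschitz:
  assumes "tame q"
  obtains B where "0 \<le> B" "\<And>x y. Re x < 1 \<or> x = 1 \<Longrightarrow> Re y < 1 \<or> y = 1 \<Longrightarrow>
    cmod (flat_ext q x - flat_ext q y) \<le> B * cmod (x - y)"
proof -
  obtain p where p: "tame p" "\<And>s. s\<in>sector \<Longrightarrow> (q has_field_derivative p s) (at s)"
    using tame_derivative[OF assms] by blast
  have "tame (\<lambda>s. s ^ 3 * (1 / 2) * (p s - tanh s * q s))"
    by (intro tame_mult tame_power tame_diff tame_const tame_id tame_tanh p assms)
  then have "tame (\<lambda>s. s ^ 3 / 2 * (p s - tanh s * q s))" by simp
  from flat_ext_flat[OF this, of 0] obtain C where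
    C: "0 \<le> C" "\<And>z. Re z < 1 \<or> z = 1 \<Longrightarrow> cmod (flat_ext (\<lambda>s. s ^ 3 / 2 * (p s - tanh s * q s)) z) \<le> C"
    by auto
  obtain D where D: "0 \<le> D" "\<And>z. Re z < 1 \<or> z = 1 \<Longrightarrow> cmod (flat_ext q z) \<le> D * cmod (1 - z)"
    using flat_ext_flat[OF assms, of 1] by auto
  have *: "cmod (flat_ext q x - flat_ext q y) \<le> C * cmod (x - y)" if "Re x < 1" "Re y < 1" for x y
  proof (rule field_differentiable_bound[of "{z. Re z < 1}"])
    show "convex {z. Re z < 1}" by (rule convex_halfspace_Re_lt)
    show "(flat_ext q has_field_derivative flat_ext (\<lambda>s. s ^ 3 / 2 * (p s - tanh s * q s)) z)
        (at z within {z. Re z < 1})" if "z \<in> {z. Re z < 1}" for z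
      using that by (intro DERIV_subset[OF has_field_derivative_flat_ext] p(2)) auto
  qed (use that C in auto)
  show ?thesis
  proof
    show "cmod (flat_ext q x - flat_ext q y) \<le> (C + D) * cmod (x - y)"
      if xy: "Re x < 1 \<or> x = 1" "Re y < 1 \<or> y = 1" for x y
    proof (cases "x = 1 \<or> y = 1")
      case True
      then have "cmod (flat_ext q x - flat_ext q y) \<le> D * cmod (x - y)"
        using D(2)[of x] D(2)[of y] xy by (auto simp: norm_minus_commute)
      also have "\<dots> \<le> (C + D) * cmod (x - y)" using C D by (intro mult_right_mono) auto
      finally show ?thesis .
    next
      case False
      then have "cmod (flat_ext q x - flat_ext q y) \<le> C * cmod (x - y)" using xy * by auto
      also have "\<dots> \<le> (C + D) * cmod (x - y)" using C D by (intro mult_right_mono) auto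
      finally show ?thesis .
    qed
  qed (use C D in auto)
qed

text \<open>The closed disc meets the line Re z = 1 only at 1, so the half plane estimates cover all
  of it.\<close>

lemma Re_less_1_or_eq_1: "Re z < 1 \<or> z = 1" if "cmod z \<le> 1"
proof (rule disjCI)
  assume "z \<noteq> 1"
  show "Re z < 1"
  proof (rule ccontr)
    assume "\<not> Re z < 1"
    moreover have "(Re z)\<^sup>2 + (Im z)\<^sup>2 \<le> 1" using that
      by (metis cmod_power2 norm_ge_zero one_power2 power_mono)
    moreover have "1 \<le> (Re z)\<^sup>2" if "1 \<le> Re z" using that by simp
    ultimately have "Re z = 1 \<and> Im z = 0"
      by (smt (verit) complex_Re_le_cmod power2_eq_square sum_power2_ge_zero that zero_eq_power2 zero_le_power2)
    with \<open>z \<noteq> 1\<close> show False by (auto simp: complex_eq_iff)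
  qed
qed

section \<open>Flat functions along the unit circle\<close>

definition circ :: "real \<Rightarrow> complex" where "circ t = cis (2 * pi * t)"

lemma cmod_circ [simp]: "cmod (circ t) = 1"
  by (simp add: circ_def)

lemma has_vector_derivative_circ: "(circ has_vector_derivative 2 * pi * \<i> * circ t) (at t)"
proof -
  have "((\<lambda>t. exp (\<i> * of_real (2 * pi * t))) has_vector_derivative
      (2 * pi * \<i>) * exp (\<i> * of_real (2 * pi * t))) (at t)"
    by (rule has_vector_derivative_eq_rhs, rule field_vector_diff_chain_at[of "\<lambda>t. \<i> * of_real (2 * pi * t)" "\<i> * (2 * pi)" t exp, unfolded o_def])
       (auto intro!: derivative_eq_intros has_vector_derivative_of_real simp: has_vector_derivative_def scaleR_conv_of_real field_simps)
  then show ?thesis by (simp add: circ_def[abs_def] cis_conv_exp)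
qed

lemma circ_add: "circ (x + y) = circ x * circ y"
  by (simp add: circ_def cis_mult distrib_left)

lemma cmod_circ_diff_le: "cmod (circ x - circ y) \<le> 2 * pi * \<bar>x - y\<bar>"
proof -
  have "circ x - circ y = circ y * (circ (x - y) - 1)"
    using circ_add[of y "x - y"] by (simp add: algebra_simps)
  also have "cmod \<dots> = cmod (exp (\<i> * of_real (2 * pi * (x - y))) - 1)"
    by (simp add: norm_mult) (simp add: circ_def cis_conv_exp)
  also have "\<dots> \<le> 2 * \<bar>2 * pi * (x - y) / 2\<bar>"
    unfolding dist_exp_i_1 by (intro mult_left_mono abs_sin_x_le_abs_x) auto
  finally show ?thesis by (simp add: abs_mult)
qed

text \<open>Differentiation along the circle stays within flat extensions of tame functions. This
  includes the point 1 and is the source of smoothness there.\<close>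

lemma flat_ext_circ_derivative:
  assumes "tame q"
  obtains q' where "tame q'"
    "\<And>t. ((\<lambda>t. flat_ext q (circ t)) has_vector_derivative flat_ext q' (circ t)) (at t)"
proof -
  obtain p where p: "tame p" "\<And>s. s\<in>sector \<Longrightarrow> (q has_field_derivative p s) (at s)"
    using tame_derivative[OF assms] by blast
  \<comment> \<open>On the circle \<open>d/dt = 2 \<pi> i z d/dz\<close>; the factor \<open>z = 1 - 1 / s\<^sup>2\<close>, which is not tame, is
    absorbed by the factor \<open>s ^ 3 / 2\<close> coming from the derivative of \<open>tau\<close>.\<close>
  define q' where "q' = (\<lambda>s. pi * \<i> * (s ^ 3 - s) * (p s - tanh s * q s))"
  have "((\<lambda>t. flat_ext q (circ t)) has_vector_derivative flat_ext q' (circ t)) (at t)" for t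
  proof (cases "circ t = 1")
    case False
    define z s where "z = circ t" and "s = tau z"
    have z: "Re z < 1" using False Re_less_1_or_eq_1[of z] by (auto simp: z_def)
    have "s ^ 2 = inverse (1 - z)" by (simp add: s_def tau_power2)
    moreover have "1 - z \<noteq> 0" using z by auto
    ultimately have "s ^ 2 * (1 - z) = 1" by simp
    then have "z * s ^ 2 = s ^ 2 - 1" by (simp add: algebra_simps)
    then have zs: "z * s ^ 3 = s ^ 3 - s" by algebra
    have "((flat_ext q \<circ> circ) has_vector_derivative
       (2 * pi * \<i> * circ t) * flat_ext (\<lambda>s. s ^ 3 / 2 * (p s - tanh s * q s)) (circ t)) (at t)"
      using z unfolding z_def
      by (intro field_vector_diff_chain_at has_vector_derivative_circ has_field_derivative_flat_ext p(2))
    moreover have "(2 * pi * \<i> * circ t) * flat_ext (\<lambda>s. s ^ 3 / 2 * (p s - tanh s * q s)) (circ t)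
       = pi * \<i> * (z * s ^ 3) * (p s - tanh s * q s) / cosh s"
      using False by (simp add: flat_ext_def z_def s_def)
    ultimately show ?thesis using False
      by (simp add: o_def zs) (simp add: flat_ext_def q'_def z_def s_def)
  next
    case True
    \<comment> \<open>Flatness of order 2 makes the difference quotient at \<open>t\<close> of size
      O(|x - t|), so the derivative is 0, the value of every flat extension at 1.\<close>
    obtain B where B: "0 \<le> B" "\<And>z. Re z < 1 \<or> z = 1 \<Longrightarrow> cmod (flat_ext q z) \<le> B * cmod (1 - z) ^ 2"
      using flat_ext_flat[OF assms, of 2] by auto
    have bnd: "cmod (flat_ext q (circ x)) \<le> B * (2 * pi) ^ 2 * \<bar>x - t\<bar> ^ 2" for x
    proof -
      have "cmod (flat_ext q (circ x)) \<le> B * cmod (1 - circ x) ^ 2"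
        using Re_less_1_or_eq_1[of "circ x"] by (intro B) auto
      also have "\<dots> \<le> B * (2 * pi * \<bar>t - x\<bar>) ^ 2"
        using B(1) cmod_circ_diff_le[of t x] True by (intro mult_left_mono power_mono) auto
      finally show ?thesis by (simp add: power_mult_distrib power2_commute mult_ac)
    qed
    have "((\<lambda>x. norm ((flat_ext q (circ x) - flat_ext q (circ t)) - (x - t) *\<^sub>R flat_ext q' (circ t)) / norm (x - t))
      \<longlongrightarrow> 0) (at t)"
    proof (rule Lim_null_comparison)
      show "\<forall>\<^sub>F x in at t. norm (norm ((flat_ext q (circ x) - flat_ext q (circ t)) - (x - t) *\<^sub>R flat_ext q' (circ t)) / norm (x - t))
          \<le> B * (2 * pi) ^ 2 * \<bar>x - t\<bar>"
        using eventually_neq_at_within[of t]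
      proof eventually_elim
        case (elim x)
        have "cmod (flat_ext q (circ x)) \<le> (B * (2 * pi) ^ 2 * \<bar>x - t\<bar>) * \<bar>x - t\<bar>"
          using bnd[of x] by (simp only: power2_eq_square mult.assoc)
        with elim show ?case by (simp add: True pos_divide_le_eq)
      qed
      show "((\<lambda>x. B * (2 * pi)\<^sup>2 * \<bar>x - t\<bar>) \<longlongrightarrow> 0) (at t)"
        by (auto intro!: tendsto_eq_intros)
    qed
    then show ?thesis
      unfolding has_vector_derivative_def has_derivative_iff_norm
      by (simp add: bounded_linear_scaleR_left)
  qed
  moreover have "tame q'" unfolding q'_def
    by (intro tame_mult tame_power tame_diff tame_const tame_id tame_tanh p assms)
  ultimately show ?thesis using that by blast
qed

subsection \<open>The reflected function and damping\<close>

text \<open>The entire function with power series sum of u^n / (2n)!: as cosh is even, the choice of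
  the root does not matter.\<close>

definition cosh_sqrt :: "complex \<Rightarrow> complex" where
  "cosh_sqrt u = cosh (csqrt u)"

lemma cosh_sqrt_power2: "cosh_sqrt (s ^ 2) = cosh s"
proof -
  have "(csqrt (s ^ 2)) ^ 2 = s ^ 2" by simp
  then have "csqrt (s ^ 2) = s \<or> csqrt (s ^ 2) = - s" using power2_eq_iff by blast
  then show ?thesis by (auto simp: cosh_sqrt_def)
qed

lemma cosh_sqrt_conv_cos: "cosh_sqrt u = cos (csqrt (- u))"
proof -
  have "(\<i> * csqrt (- u)) ^ 2 = u" by (simp add: power_mult_distrib)
  then have "cosh_sqrt u = cosh (\<i> * csqrt (- u))" using cosh_sqrt_power2 by metis
  then show ?thesis by (simp add: cos_conv_cosh)
qed

text \<open>The formulas cosh (csqrt u) and cos (csqrt (- u)) have opposite branch cuts, which share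
  only 0; continuity removes that singularity.\<close>

lemma holomorphic_cosh_sqrt: "cosh_sqrt holomorphic_on UNIV"
proof -
  have 1: "cosh_sqrt holomorphic_on - \<real>\<^sub>\<le>\<^sub>0"
  proof -
    have "(\<lambda>u. cosh (csqrt u)) holomorphic_on - \<real>\<^sub>\<le>\<^sub>0"
      unfolding cosh_def by (intro holomorphic_intros) auto
    then show ?thesis by (simp add: cosh_sqrt_def[abs_def])
  qed
  have 2: "cosh_sqrt holomorphic_on - \<real>\<^sub>\<ge>\<^sub>0"
  proof -
    have "(\<lambda>u. cos (csqrt (- u))) holomorphic_on - \<real>\<^sub>\<ge>\<^sub>0"
      by (intro holomorphic_intros) (auto simp: complex_nonpos_Reals_iff complex_nonneg_Reals_iff)
    then show ?thesis by (simp add: cosh_sqrt_conv_cos[abs_def])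
  qed
  have "cosh_sqrt holomorphic_on (- \<real>\<^sub>\<le>\<^sub>0) \<union> (- \<real>\<^sub>\<ge>\<^sub>0)"
    using 1 2 by (intro holomorphic_on_Un) (auto simp: open_Compl)
  moreover have "- \<real>\<^sub>\<le>\<^sub>0 \<union> - \<real>\<^sub>\<ge>\<^sub>0 = (UNIV - {0} :: complex set)"
    by (auto simp: complex_nonpos_Reals_iff complex_nonneg_Reals_iff complex_eq_iff)
  ultimately have hol: "cosh_sqrt holomorphic_on UNIV - {0}" by simp
  show ?thesis
  proof (rule no_isolated_singularity'[OF _ hol])
    fix z :: complex assume "z \<in> {0}"
    have "((\<lambda>u::complex. cmod (csqrt u)) \<longlongrightarrow> 0) (at 0)"
      by (auto intro!: tendsto_eq_intros)
    then have "(csqrt \<longlongrightarrow> 0) (at 0)" by (rule tendsto_norm_zero_cancel)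
    then have "((\<lambda>u. cosh (csqrt u)) \<longlongrightarrow> cosh 0) (at 0)" by (rule tendsto_cosh)
    with \<open>z \<in> {0}\<close> show "(cosh_sqrt \<longlongrightarrow> cosh_sqrt z) (at z within UNIV)"
      by (simp add: cosh_sqrt_def[abs_def])
  qed auto
qed

lemma cmod_cosh_sqrt_le: "cmod (cosh_sqrt u) \<le> exp (sqrt (cmod u))"
proof -
  have "cmod (cosh s) \<le> exp (cmod s)" for s :: complex
  proof -
    have "cmod (cosh s) \<le> (cmod (exp s) + cmod (exp (-s))) / 2"
      unfolding cosh_def using norm_triangle_ineq[of "exp s" "exp (-s)"] by simp
    also have "\<dots> \<le> exp (cmod s)"
    proof -
      have "exp (Re s) \<le> exp (cmod s)" "exp (- Re s) \<le> exp (cmod s)"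
        using abs_Re_le_cmod[of s] by auto
      then have "exp (Re s) + exp (- Re s) \<le> 2 * exp (cmod s)" by linarith
      then show ?thesis by simp
    qed
    finally show ?thesis .
  qed
  from this[of "csqrt u"] show ?thesis by (simp add: cosh_sqrt_def)
qed

lemma cnj_cosh: "cnj (cosh s) = cosh (cnj s)"
  by (simp add: cosh_def exp_cnj)

text \<open>The factor \<open>exp (- 4 * tau z)\<close> beats the growth \<open>exp (2 * Re (tau z))\<close> of the functions it is
  applied to, which makes the product continuous at \<open>1\<close>.\<close>

definition damped :: "(complex \<Rightarrow> complex) \<Rightarrow> complex \<Rightarrow> complex" where
  "damped A z = (if z = 1 then 0 else exp (- 4 * tau z) * A z)"

lemma holomorphic_tau: "tau holomorphic_on {z. Re z < 1}"
  using has_field_derivative_tau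
  by (auto simp: holomorphic_on_def field_differentiable_def intro: DERIV_subset)

lemma holomorphic_damped:
  assumes "A holomorphic_on {z. Re z < 1}"
  shows "damped A holomorphic_on {z. Re z < 1}"
proof -
  have "(\<lambda>z. exp (- 4 * tau z) * A z) holomorphic_on {z. Re z < 1}"
    by (intro holomorphic_intros holomorphic_tau assms)
  then show ?thesis by (rule holomorphic_transform) (auto simp: damped_def)
qed

text \<open>The open half plane is a neighbourhood of every point of the closed disc other than 1,
  so only the limit at 1 is at stake.\<close>

lemma continuous_on_cball_if_at_1:
  assumes "f holomorphic_on {z. Re z < 1}" "(f \<longlongrightarrow> f 1) (at 1 within cball 0 1)"
  shows "continuous_on (cball 0 1) f"
  unfolding continuous_on_eq_continuous_within
proof
  fix z :: complex assume z: "z \<in> cball 0 1"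
  show "continuous (at z within cball 0 1) f"
  proof (cases "z = 1")
    case True
    with assms(2) show ?thesis by (simp add: continuous_within)
  next
    case False
    then have "Re z < 1" using z Re_less_1_or_eq_1[of z] by auto
    with assms(1) have "isCont f z"
      by (metis continuous_on_eq_continuous_at holomorphic_on_imp_continuous_on mem_Collect_eq open_halfspace_Re_lt)
    then show ?thesis by (rule continuous_at_imp_continuous_at_within)
  qed
qed

text \<open>With x = Re (tau z), damping leaves at most |M| exp (- 2x). Since exp (2x) \<ge> 2x
  \<ge> |tau z|, this is at most |M| sqrt |1 - z|, which tends to 0.\<close>

lemma continuous_on_damped:
  assumes "A holomorphic_on {z. Re z < 1}"
    and bound: "\<And>z. z \<in> cball 0 1 \<Longrightarrow> z \<noteq> 1 \<Longrightarrow> cmod (A z) \<le> M * exp (2 * Re (tau z))"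
  shows "continuous_on (cball 0 1) (damped A)"
proof (rule continuous_on_cball_if_at_1[OF holomorphic_damped[OF assms(1)]])
  have le: "cmod (damped A z) \<le> \<bar>M\<bar> * sqrt (cmod (1 - z))" if z: "z \<in> cball 0 1" for z
  proof (cases "z = 1")
    case False
    then have "Re z < 1" using z Re_less_1_or_eq_1[of z] by auto
    then have s: "tau z \<in> sector" by (rule tau_in_sector)
    define x where "x = Re (tau z)"
    have x: "0 < x" "cmod (tau z) \<le> 2 * x"
      using s cmod_sector_le[OF s] by (auto simp: x_def sector_def)
    have "cmod (damped A z) = exp (- 4 * x) * cmod (A z)"
      using False by (simp add: damped_def norm_mult x_def)
    also have "\<dots> \<le> exp (- 4 * x) * (\<bar>M\<bar> * exp (2 * x))"
      using bound[OF z False] by (intro mult_left_mono) (auto simp: x_def intro: order_trans mult_right_mono)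
    also have "\<dots> = \<bar>M\<bar> * exp (- (2 * x))" by (simp add: exp_add[symmetric])
    also have "\<dots> \<le> \<bar>M\<bar> * (1 / cmod (tau z))"
    proof (intro mult_left_mono)
      have "cmod (tau z) \<le> exp (2 * x)" using x exp_ge_add_one_self[of "2 * x"] by linarith
      moreover have "0 < cmod (tau z)" using s by (auto simp: sector_def)
      ultimately show "exp (- (2 * x)) \<le> 1 / cmod (tau z)"
        by (simp add: exp_minus field_simps)
    qed auto
    finally show ?thesis by (simp add: cmod_tau)
  qed (simp add: damped_def)
  have "(damped A \<longlongrightarrow> 0) (at 1 within cball 0 1)"
  proof (rule Lim_null_comparison)
    show "\<forall>\<^sub>F z in at 1 within cball 0 1. norm (damped A z) \<le> \<bar>M\<bar> * sqrt (cmod (1 - z))"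
      unfolding eventually_at_filter using le by (auto intro: always_eventually)
    show "((\<lambda>z. \<bar>M\<bar> * sqrt (cmod (1 - z))) \<longlongrightarrow> 0) (at 1 within cball 0 1)"
      by (auto intro!: tendsto_eq_intros)
  qed
  then show "(damped A \<longlongrightarrow> damped A 1) (at 1 within cball 0 1)" by (simp add: damped_def)
qed

subsection \<open>Analytic curves tangent to infinite order to the circle\<close>

text \<open>Otherwise h w = w^n * g w near 0 with g 0 nonzero, whereas flatness of order n + 1 along
  the reals forces g to tend to 0.\<close>

lemma holomorphic_flat_on_reals_zero:
  fixes h :: "complex \<Rightarrow> complex"
  assumes h: "h holomorphic_on ball 0 r"
    and flat: "\<And>N. \<exists>C. \<forall>x::real. \<bar>x\<bar> < r \<longrightarrow> cmod (h (of_real x)) \<le> C * \<bar>x\<bar> ^ N"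
    and w: "w \<in> ball 0 r"
  shows "h w = 0"
proof (rule ccontr)
  assume nz: "h w \<noteq> 0"
  have "0 < r" using w by (auto intro: le_less_trans[OF norm_ge_zero])
  obtain C where "\<forall>x::real. \<bar>x\<bar> < r \<longrightarrow> cmod (h (of_real x)) \<le> C * \<bar>x\<bar> ^ 1" using flat by blast
  with \<open>0 < r\<close> have h0: "h 0 = 0" by (metis abs_zero mult_zero_right norm_le_zero_iff of_real_0 power_one_right)
  have "\<not> h constant_on ball 0 r"
  proof
    assume "h constant_on ball 0 r"
    then obtain c where "\<And>z. z \<in> ball 0 r \<Longrightarrow> h z = c" by (auto simp: constant_on_def)
    then show False using h0 nz w \<open>0 < r\<close> by (metis centre_in_ball)
  qed
  then obtain g r' n where g: "0 < n" "0 < r'" "ball 0 r' \<subseteq> ball (0::complex) r"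
      "g holomorphic_on ball 0 r'" "\<And>w. w \<in> ball 0 r' \<Longrightarrow> h w = (w - 0) ^ n * g w"
      "\<And>w. w \<in> ball 0 r' \<Longrightarrow> g w \<noteq> 0"
    using \<open>0 < r\<close> h0
    by (elim holomorphic_factor_zero_nonconstant[OF h open_ball connected_ball, of 0, rotated 2]) auto
  obtain C where C: "\<And>x::real. \<bar>x\<bar> < r \<Longrightarrow> cmod (h (of_real x)) \<le> C * \<bar>x\<bar> ^ Suc n" using flat by blast
  have "r' \<le> r" using g(2,3) by (metis ball_subset_ball_iff dist_self add_0 not_less)
  have "isCont g 0"
    using g(2,4) by (metis centre_in_ball continuous_on_eq_continuous_at holomorphic_on_imp_continuous_on open_ball)
  then have "isCont (\<lambda>x::real. g (of_real x)) 0"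
    by (intro isCont_o2[where g = g and f = of_real]) auto
  then have lim: "((\<lambda>x::real. g (of_real x)) \<longlongrightarrow> g 0) (at 0)"
    by (simp add: isCont_def)
  have "((\<lambda>x::real. g (of_real x)) \<longlongrightarrow> 0) (at 0)"
  proof (rule Lim_null_comparison)
    have "\<forall>\<^sub>F x::real in at 0. x \<noteq> 0 \<and> \<bar>x\<bar> < r'"
      unfolding eventually_at using \<open>0 < r'\<close> by (intro exI[of _ r']) auto
    then show "\<forall>\<^sub>F x::real in at 0. norm (g (of_real x)) \<le> C * \<bar>x\<bar>"
    proof eventually_elim
      case (elim x)
      have "\<bar>x\<bar> ^ n * cmod (g (of_real x)) = cmod (h (of_real x))"
        using g(5)[of "of_real x"] elim by (simp add: norm_mult norm_power)
      also have "\<dots> \<le> \<bar>x\<bar> ^ n * (C * \<bar>x\<bar>)" using C[of x] elim \<open>r' \<le> r\<close> by (simp add: mult_ac)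
      finally show ?case using elim by simp
    qed
    show "((\<lambda>x::real. C * \<bar>x\<bar>) \<longlongrightarrow> 0) (at 0)" by (auto intro!: tendsto_eq_intros)
  qed
  with lim have "g 0 = 0" by (metis LIM_unique)
  with g(2,6) show False by simp
qed

text \<open>On the real axis |\<gamma>|^2 - 1 is the restriction of the holomorphic function f x *
  cnj (f (cnj x)) - 1, where f is the sum of the power series; flatness makes it vanish.\<close>

lemma real_analytic_unimodular_if_flat:
  fixes \<gamma> :: "real \<Rightarrow> complex"
  assumes sums: "\<And>s. \<bar>s - t\<bar> < r \<Longrightarrow> (\<lambda>n. a n * of_real (s - t) ^ n) sums \<gamma> s"
    and flat: "\<And>N. \<exists>C. \<forall>s. \<bar>s - t\<bar> < r \<longrightarrow> \<bar>(cmod (\<gamma> s))\<^sup>2 - 1\<bar> \<le> C * \<bar>s - t\<bar> ^ N"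
    and s: "\<bar>s - t\<bar> < r"
  shows "cmod (\<gamma> s) = 1"
proof -
  define f where "f x = (\<Sum>n. a n * x ^ n)" for x :: complex
  have "(\<lambda>n. a n * x ^ n) sums f x" if x: "cmod x < r" for x
  proof -
    \<comment> \<open>The hypothesis gives convergence at real points only; convergence at a real u
      beyond |x| yields it at the complex point x.\<close>
    obtain u where u: "cmod x < u" "u < r" using dense[OF x] by blast
    then have "0 < u" using norm_ge_zero[of x] by linarith
    have "summable (\<lambda>n. a n * complex_of_real u ^ n)"
      using sums[of "t + u"] u \<open>0 < u\<close> by (auto simp: sums_iff)
    then have "summable (\<lambda>n. a n * x ^ n)" by (rule powser_inside) (use u \<open>0 < u\<close> in auto)
    then show ?thesis by (simp add: f_def summable_sums)
  qed
  then have f: "f holomorphic_on ball 0 r"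
    by (intro power_series_holomorphic[of 0 r a]) auto
  have "(cnj \<circ> f \<circ> cnj) holomorphic_on ball 0 r"
    by (rule holomorphic_on_compose_cnj_cnj) (auto intro!: holomorphic_on_subset[OF f])
  then have h: "(\<lambda>x. f x * (cnj \<circ> f \<circ> cnj) x - 1) holomorphic_on ball 0 r"
    by (intro holomorphic_intros f)
  have fx: "f (of_real x) = \<gamma> (t + x)" if "\<bar>x\<bar> < r" for x
    using sums[of "t + x"] that by (simp add: f_def sums_iff)
  have hx: "f (of_real x) * (cnj \<circ> f \<circ> cnj) (of_real x) - 1 = of_real ((cmod (\<gamma> (t + x)))\<^sup>2 - 1)"
    if "\<bar>x\<bar> < r" for x
    by (simp add: fx that complex_norm_square[symmetric])
  have "f (of_real (s - t)) * (cnj \<circ> f \<circ> cnj) (of_real (s - t)) - 1 = 0"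
  proof (rule holomorphic_flat_on_reals_zero[OF h])
    fix N
    obtain C where C: "\<And>s. \<bar>s - t\<bar> < r \<Longrightarrow> \<bar>(cmod (\<gamma> s))\<^sup>2 - 1\<bar> \<le> C * \<bar>s - t\<bar> ^ N"
      using flat by blast
    show "\<exists>C. \<forall>x. \<bar>x\<bar> < r \<longrightarrow> cmod (f (complex_of_real x) * (cnj \<circ> f \<circ> cnj) (complex_of_real x) - 1) \<le> C * \<bar>x\<bar> ^ N"
    proof (intro exI[of _ C] allI impI)
      fix x :: real assume x: "\<bar>x\<bar> < r"
      show "cmod (f (complex_of_real x) * (cnj \<circ> f \<circ> cnj) (complex_of_real x) - 1) \<le> C * \<bar>x\<bar> ^ N"
        unfolding hx[OF x] norm_of_real using C[of "t + x"] x by simp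
    qed
  qed (use s in \<open>simp del: of_real_diff\<close>)
  with hx[of "s - t"] s have "(cmod (\<gamma> s))\<^sup>2 - 1 = 0" by (metis add_diff_cancel_left' add.commute diff_add_cancel of_real_eq_0_iff)
  then show ?thesis by (simp add: power2_eq_1_iff) (smt (verit) norm_ge_zero)
qed

subsection \<open>The perturbed disc\<close>

text \<open>Periodicity reduces \<open>t\<close> to its fractional part. Local arguments around a
  parameter may leave \<open>{0..1}\<close>, so membership is needed for all real
  \<open>t\<close>.\<close>

lemma regular_jordan_param_in:
  assumes "regular_jordan_param \<gamma> S"
  shows "\<gamma> t \<in> S"
proof -
  have per: "\<gamma> (t + 1) = \<gamma> t" for t using assms by (simp add: regular_jordan_param_def)
  have nat: "\<gamma> (t + real n) = \<gamma> t" for t n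
  proof (induction n)
    case (Suc n)
    then show ?case using per[of "t + real n"] by (simp add: add_ac)
  qed simp
  have "\<gamma> (t + of_int k) = \<gamma> t" for k
  proof (cases k)
    case (neg n)
    then show ?thesis using nat[of "t + of_int k" "Suc n"] by simp
  qed (use nat in simp)
  from this[of "- \<lfloor>t\<rfloor>"] have "\<gamma> t = \<gamma> (frac t)" by (simp add: frac_def)
  also have "\<dots> \<in> path_image \<gamma>"
    unfolding path_image_def using frac_lt_1[of t] by (intro imageI) (auto simp: less_imp_le)
  finally show ?thesis using assms by (simp add: regular_jordan_param_def)
qed

text \<open>Smallness of \<open>\<epsilon>\<close> in the two forms needed: Lipschitz constant 1/2
  keeps the perturbed identity injective on the closed disc, and a perturbation slower than 2 pi,
  the speed of \<open>circ\<close>, cannot stop the boundary curve.\<close>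

locale flat_perturbation =
  fixes \<epsilon> :: real
  assumes eps_pos: "0 < \<epsilon>"
    and lip: "\<And>x y. x \<in> cball 0 1 \<Longrightarrow> y \<in> cball 0 1 \<Longrightarrow>
      cmod (\<epsilon> * flat_ext (\<lambda>_. 1) x - \<epsilon> * flat_ext (\<lambda>_. 1) y) \<le> cmod (x - y) / 2"
    and speed: "\<And>t. \<exists>D. ((\<lambda>t. flat_ext (\<lambda>_. 1) (circ t)) has_vector_derivative D) (at t)
      \<and> \<epsilon> * cmod D < 2 * pi"
begin

section \<open>The map \<open>phi\<close> and the topology of its image\<close>

definition phi :: "complex \<Rightarrow> complex" where
  "phi z = z + \<epsilon> * flat_ext (\<lambda>_. 1) z"

abbreviation \<Omega> :: "complex set" where "\<Omega> \<equiv> phi ` ball 0 1"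

definition psi :: "complex \<Rightarrow> complex" where
  "psi = inv_into (cball 0 1) phi"

lemma phi_1 [simp]: "phi 1 = 1"
  by (simp add: phi_def)

text \<open>A 1/2-Lipschitz perturbation of the identity at most halves distances. Besides
  injectivity, this lets distances to 1 be measured on the boundary curve instead of the
  circle.\<close>

lemma phi_expanding:
  assumes "x \<in> cball 0 1" "y \<in> cball 0 1"
  shows "cmod (x - y) \<le> 2 * cmod (phi x - phi y)"
proof -
  have "x - y = (phi x - phi y) - (\<epsilon> * flat_ext (\<lambda>_. 1) x - \<epsilon> * flat_ext (\<lambda>_. 1) y)"
    by (simp add: phi_def algebra_simps)
  then have "cmod (x - y) \<le> cmod (phi x - phi y) + cmod (x - y) / 2"
    using lip[OF assms] norm_triangle_ineq4 by (metis add_left_mono order_trans)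
  then show ?thesis by simp
qed

lemma inj_on_phi: "inj_on phi (cball 0 1)"
  using phi_expanding by (fastforce intro: inj_onI)

lemma holomorphic_phi: "phi holomorphic_on {z. Re z < 1}"
proof -
  have "flat_ext (\<lambda>_. 1) holomorphic_on {z. Re z < 1}"
    using has_field_derivative_flat_ext[of "\<lambda>_. 1" "\<lambda>_. 0"]
    by (auto simp: holomorphic_on_def field_differentiable_def intro: DERIV_subset)
  then show ?thesis unfolding phi_def[abs_def] by (intro holomorphic_intros)
qed

lemma ball_subset_halfplane: "ball 0 1 \<subseteq> {z. Re z < 1}"
  by (auto intro: le_less_trans[OF complex_Re_le_cmod])

lemma holomorphic_phi_ball: "phi holomorphic_on ball 0 1"
  by (rule holomorphic_on_subset[OF holomorphic_phi ball_subset_halfplane])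

lemma continuous_on_phi: "continuous_on (cball 0 1) phi"
proof -
  have "continuous_on (cball 0 1) (\<lambda>z. \<epsilon> * flat_ext (\<lambda>_. 1) z)"
    by (rule lipschitz_on_continuous_on[of "1 / 2"]) (use lip in \<open>auto simp: lipschitz_on_def dist_norm\<close>)
  then show ?thesis unfolding phi_def[abs_def] by (rule continuous_on_add[OF continuous_on_id])
qed

lemma psi_phi [simp]: "z \<in> cball 0 1 \<Longrightarrow> psi (phi z) = z"
  unfolding psi_def by (rule inv_into_f_f[OF inj_on_phi])

lemma continuous_on_psi: "continuous_on (phi ` cball 0 1) psi"
  by (rule continuous_on_inv[OF continuous_on_phi]) auto

lemma holomorphic_psi: "psi holomorphic_on \<Omega>"
proof -
  have "inj_on phi (ball 0 1)" using inj_on_phi by (rule inj_on_subset) auto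
  then obtain g where "g holomorphic_on \<Omega>" "\<And>z. z \<in> ball 0 1 \<Longrightarrow> g (phi z) = z"
    using holomorphic_has_inverse[OF holomorphic_phi_ball open_ball] by metis
  then show ?thesis by (elim holomorphic_transform) auto
qed

lemma open_\<Omega>: "open \<Omega>"
  using holomorphic_phi_ball by (rule open_mapping_thm3) (auto intro: inj_on_subset[OF inj_on_phi])

lemma closure_\<Omega>: "closure \<Omega> = phi ` cball 0 1"
proof
  have "compact (phi ` cball 0 1)" by (intro compact_continuous_image continuous_on_phi compact_cball)
  then show "closure \<Omega> \<subseteq> phi ` cball 0 1"
    by (intro closure_minimal compact_imp_closed) auto
  have "phi ` closure (ball 0 1) \<subseteq> closure \<Omega>"
    by (rule image_closure_subset) (auto simp: continuous_on_phi closure_subset)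
  then show "phi ` cball 0 1 \<subseteq> closure \<Omega>" by simp
qed

lemma frontier_\<Omega>: "frontier \<Omega> = phi ` sphere 0 1"
proof -
  have "frontier \<Omega> = phi ` cball 0 1 - \<Omega>"
    by (simp add: frontier_def closure_\<Omega> interior_open open_\<Omega>)
  also have "\<dots> = phi ` (cball 0 1 - ball 0 1)"
    by (rule inj_on_image_set_diff[OF inj_on_phi, symmetric]) auto
  also have "cball 0 1 - ball 0 1 = (sphere 0 1 :: complex set)" by auto
  finally show ?thesis .
qed

lemma bounded_\<Omega>: "bounded \<Omega>"
proof -
  have "compact (phi ` cball 0 1)" by (intro compact_continuous_image continuous_on_phi compact_cball)
  then show ?thesis by (rule bounded_subset[OF compact_imp_bounded]) auto
qed

lemma connected_\<Omega>: "connected \<Omega>"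
  by (intro connected_continuous_image continuous_on_subset[OF continuous_on_phi]) auto

lemma simply_connected_\<Omega>: "simply_connected \<Omega>"
proof -
  have "homeomorphism (ball 0 1) \<Omega> phi psi"
    by (auto simp: homeomorphism_def image_image intro!: continuous_on_subset[OF continuous_on_phi]
        continuous_on_subset[OF continuous_on_psi])
  then have "ball (0::complex) 1 homeomorphic \<Omega>" by (auto simp: homeomorphic_def)
  then show ?thesis
    by (metis homeomorphic_simply_connected convex_imp_simply_connected convex_ball)
qed

section \<open>The two functions and the boundary relation\<close>

text \<open>On the unit circle \<open>cnj (1 / (1 - z)) = - z / (1 - z)\<close>, so there
  \<open>cnj (phi z) = 1 / z + \<epsilon> / cosh_sqrt (- z / (1 - z))\<close>: numerator and denominator of this quotient,
  both damped, are \<open>G1\<close> and \<open>G2\<close>.\<close>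

definition G2 :: "complex \<Rightarrow> complex" where
  "G2 = damped (\<lambda>z. z * cosh_sqrt (- z / (1 - z)))"

definition G1 :: "complex \<Rightarrow> complex" where
  "G1 = damped (\<lambda>z. cosh_sqrt (- z / (1 - z)) + \<epsilon> * z)"

text \<open>The modulus of the argument is at most 1 / |1 - z| = |tau z|^2, and |tau z| \<le> 2 Re
  (tau z) on the sector. This is the growth that \<open>damped\<close> tolerates.\<close>

lemma cmod_cosh_sqrt_reflected_le:
  assumes z: "z \<in> cball 0 1" "z \<noteq> 1"
  shows "cmod (cosh_sqrt (- z / (1 - z))) \<le> exp (2 * Re (tau z))"
proof -
  have "Re z < 1" using z Re_less_1_or_eq_1[of z] by auto
  then have s: "tau z \<in> sector" by (rule tau_in_sector)
  have "sqrt (cmod (- z / (1 - z))) \<le> sqrt (1 / cmod (1 - z))"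
    using z by (auto simp: norm_divide intro!: divide_right_mono)
  also have "\<dots> \<le> 2 * Re (tau z)"
    using cmod_sector_le[OF s] by (simp add: cmod_tau real_sqrt_divide)
  finally show ?thesis using cmod_cosh_sqrt_le[of "- z / (1 - z)"] by (meson exp_le_cancel_iff order_trans)
qed

lemma holomorphic_cosh_sqrt_reflected:
  "(\<lambda>z. cosh_sqrt (- z / (1 - z))) holomorphic_on {z. Re z < 1}"
proof -
  have "(\<lambda>z. - z / (1 - z)) holomorphic_on {z. Re z < 1}"
    by (intro holomorphic_intros) auto
  from holomorphic_on_compose_gen[OF this holomorphic_cosh_sqrt] show ?thesis by (simp add: o_def)
qed

lemma holomorphic_G1: "G1 holomorphic_on {z. Re z < 1}"
  and holomorphic_G2: "G2 holomorphic_on {z. Re z < 1}"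
  unfolding G1_def G2_def
  by (intro holomorphic_damped holomorphic_intros holomorphic_cosh_sqrt_reflected)+

lemma continuous_on_G1: "continuous_on (cball 0 1) G1"
  unfolding G1_def
proof (rule continuous_on_damped)
  fix z :: complex assume z: "z \<in> cball 0 1" "z \<noteq> 1"
  have "0 < Re (tau z)" using tau_in_sector[of z] z Re_less_1_or_eq_1[of z] by (auto simp: sector_def)
  have "cmod (cosh_sqrt (- z / (1 - z)) + \<epsilon> * z) \<le> exp (2 * Re (tau z)) + \<epsilon> * 1"
    using z eps_pos cmod_cosh_sqrt_reflected_le[OF z]
    by (intro norm_triangle_mono) (auto simp: norm_mult intro: mult_left_mono)
  also have "\<dots> \<le> (1 + \<epsilon>) * exp (2 * Re (tau z))"
    using eps_pos \<open>0 < Re (tau z)\<close> by (simp add: distrib_right)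
  finally show "cmod (cosh_sqrt (- z / (1 - z)) + \<epsilon> * z) \<le> (1 + \<epsilon>) * exp (2 * Re (tau z))" .
qed (intro holomorphic_intros holomorphic_cosh_sqrt_reflected)

lemma continuous_on_G2: "continuous_on (cball 0 1) G2"
  unfolding G2_def
proof (rule continuous_on_damped)
  fix z :: complex assume z: "z \<in> cball 0 1" "z \<noteq> 1"
  show "cmod (z * cosh_sqrt (- z / (1 - z))) \<le> 1 * exp (2 * Re (tau z))"
    unfolding norm_mult using z cmod_cosh_sqrt_reflected_le[OF z] by (intro mult_mono) auto
qed (intro holomorphic_intros holomorphic_cosh_sqrt_reflected)

text \<open>On the circle z * cnj z = 1 turns - z / (1 - z) into the square of cnj (tau z), so
  \<open>cosh_sqrt\<close> there is the conjugate of cosh (tau z); it remains to clear the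
  denominator. At 1 both sides are 0 by damping.\<close>

lemma G1_eq_cnj_phi_G2:
  assumes z: "cmod z = 1"
  shows "G1 z = cnj (phi z) * G2 z"
proof (cases "z = 1")
  case True
  then show ?thesis by (simp add: G1_def G2_def damped_def)
next
  case False
  define s where "s = tau z"
  have "Re z < 1" using False z Re_less_1_or_eq_1[of z] by auto
  then have s: "s \<in> sector" unfolding s_def by (rule tau_in_sector)
  have zz: "z * cnj z = 1" using z complex_norm_square[of z] by simp
  have "- z / (1 - z) = inverse (1 - cnj z)"
  proof -
    have "1 - cnj z \<noteq> 0" "1 - z \<noteq> 0" using False by (auto simp: complex_eq_iff)
    then show ?thesis using zz by (simp add: field_simps)
  qed
  also have "\<dots> = (cnj s) ^ 2"
    using arg_cong[OF tau_power2[of z], of cnj] by (simp add: s_def)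
  finally have c: "cosh_sqrt (- z / (1 - z)) = cnj (cosh s)"
    by (simp add: cosh_sqrt_power2 cnj_cosh)
  have nz: "cnj (cosh s) \<noteq> 0" using cosh_sector_nonzero[OF s] by simp
  have "cnj (phi z) = cnj z + \<epsilon> / cnj (cosh s)"
    using False by (simp add: phi_def flat_ext_def s_def)
  then have "cnj (phi z) * (z * cnj (cosh s)) = (z * cnj z) * cnj (cosh s) + \<epsilon> * z"
    using nz by (simp add: field_simps)
  then have "exp (- 4 * s) * (cnj (cosh s) + \<epsilon> * z)
      = cnj (phi z) * (exp (- 4 * s) * (z * cnj (cosh s)))"
    by (metis (no_types, lifting) zz mult_1 mult.left_commute)
  then show ?thesis using False by (simp only: G1_def G2_def damped_def c s_def if_False)
qed

lemma G2_nonzero: "G2 (- 1 / 2) \<noteq> 0"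
proof -
  \<comment> \<open>At z = -1/2 the reflected argument - z / (1 - z) equals 1/3. Writing it as a
    square of a point of the sector shows that \<open>cosh_sqrt\<close> does not vanish
    there.\<close>
  have "(1 / 3 :: complex) = tau (-2) ^ 2" by (simp add: tau_power2)
  then have "cosh_sqrt (1 / 3) = cosh (tau (-2))" by (simp only: cosh_sqrt_power2)
  also have "\<dots> \<noteq> 0" by (intro cosh_sector_nonzero tau_in_sector) simp
  finally have "cosh_sqrt (1 / 3) \<noteq> 0" .
  moreover have "- 1 / 2 \<noteq> (1 :: complex)" by (simp add: complex_eq_iff)
  ultimately show ?thesis by (simp add: G2_def damped_def)
qed

section \<open>Smoothness and regularity of the boundary curve\<close>

lemma circ_combination_derivative:
  assumes "tame q"
  obtains q' where "tame q'" "\<And>t. ((\<lambda>t. c * circ t + \<epsilon> * flat_ext q (circ t)) has_vector_derivative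
      (c * (2 * pi * \<i>)) * circ t + \<epsilon> * flat_ext q' (circ t)) (at t)"
proof -
  obtain q' where q': "tame q'"
    "\<And>t. ((\<lambda>t. flat_ext q (circ t)) has_vector_derivative flat_ext q' (circ t)) (at t)"
    using flat_ext_circ_derivative[OF assms] by blast
  have "((\<lambda>t. c * circ t + \<epsilon> * flat_ext q (circ t)) has_vector_derivative
      (c * (2 * pi * \<i>)) * circ t + \<epsilon> * flat_ext q' (circ t)) (at t)" for t
    by (auto intro!: derivative_eq_intros has_vector_derivative_circ q')
  with q'(1) show ?thesis by (rule that)
qed

text \<open>The family on the right contains \<open>phi \<circ> circ\<close> (c = 1, q = 1) and is
  closed under differentiation, which multiplies c by 2 pi i and replaces q by another tame
  function.\<close>

lemma phi_circ_derivatives: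
  "\<exists>c q. tame q \<and> ((\<lambda>g s. vector_derivative g (at s)) ^^ n) (phi \<circ> circ)
     = (\<lambda>t. c * circ t + \<epsilon> * flat_ext q (circ t))"
proof (induction n)
  case 0
  show ?case by (intro exI[of _ 1] exI[of _ "\<lambda>_. 1"]) (auto simp: phi_def tame_const)
next
  case (Suc n)
  then obtain c q where q: "tame q" and
    eq: "((\<lambda>g s. vector_derivative g (at s)) ^^ n) (phi \<circ> circ) = (\<lambda>t. c * circ t + \<epsilon> * flat_ext q (circ t))"
    by blast
  obtain q' where q': "tame q'" "\<And>t. ((\<lambda>t. c * circ t + \<epsilon> * flat_ext q (circ t)) has_vector_derivative
      (c * (2 * pi * \<i>)) * circ t + \<epsilon> * flat_ext q' (circ t)) (at t)"
    using circ_combination_derivative[OF q, of c] by blast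
  then have "((\<lambda>g s. vector_derivative g (at s)) ^^ Suc n) (phi \<circ> circ)
      = (\<lambda>t. (c * (2 * pi * \<i>)) * circ t + \<epsilon> * flat_ext q' (circ t))"
    by (intro ext) (simp add: eq vector_derivative_at)
  with q' show ?case by blast
qed

lemma smooth_param_phi_circ: "smooth_param (phi \<circ> circ)"
  unfolding smooth_param_def
proof (intro allI)
  fix n t
  obtain c q where q: "tame q" and
    eq: "((\<lambda>g s. vector_derivative g (at s)) ^^ n) (phi \<circ> circ) = (\<lambda>t. c * circ t + \<epsilon> * flat_ext q (circ t))"
    using phi_circ_derivatives by blast
  show "((\<lambda>g s. vector_derivative g (at s)) ^^ n) (phi \<circ> circ) differentiable (at t)"
    unfolding eq by (rule circ_combination_derivative[OF q]) (blast intro: differentiableI_vector)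
qed

lemma regular_jordan_phi_circ: "regular_jordan_param (phi \<circ> circ) (frontier \<Omega>)"
  unfolding regular_jordan_param_def
proof (intro conjI allI)
  have in_cball: "circ t \<in> cball 0 1" for t by simp
  have diff: "\<exists>D. ((phi \<circ> circ) has_vector_derivative D) (at t) \<and> D \<noteq> 0" for t
  proof -
    obtain D where D: "((\<lambda>t. flat_ext (\<lambda>_. 1) (circ t)) has_vector_derivative D) (at t)"
      "\<epsilon> * cmod D < 2 * pi" using speed by blast
    have "((\<lambda>t. circ t + \<epsilon> * flat_ext (\<lambda>_. 1) (circ t)) has_vector_derivative
        2 * pi * \<i> * circ t + \<epsilon> * D) (at t)"
      by (auto intro!: derivative_eq_intros has_vector_derivative_circ D)
    moreover have "2 * pi * \<i> * circ t + \<epsilon> * D \<noteq> 0"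
    proof
      assume "2 * pi * \<i> * circ t + \<epsilon> * D = 0"
      then have "2 * pi * \<i> * circ t = - (\<epsilon> * D)" by (simp add: eq_neg_iff_add_eq_0)
      from arg_cong[OF this, of cmod] show False
        using D(2) eps_pos by (simp add: norm_mult)
    qed
    ultimately show ?thesis by (auto simp: phi_def o_def)
  qed
  then show "(phi \<circ> circ) differentiable (at t)" "vector_derivative (phi \<circ> circ) (at t) \<noteq> 0" for t
    using diff[of t] by (auto dest: vector_derivative_at intro: differentiableI_vector)
  have "continuous_on {0..1} (phi \<circ> circ)"
    using diff by (intro continuous_at_imp_continuous_on ballI) (blast dest: has_vector_derivative_continuous)
  moreover have "x = y \<or> x = 0 \<and> y = 1 \<or> x = 1 \<and> y = 0"
    if "x \<in> {0..1}" "y \<in> {0..1}" "(phi \<circ> circ) x = (phi \<circ> circ) y" for x y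
  proof -
    have "circ x = circ y" using that inj_onD[OF inj_on_phi] in_cball by (auto simp: o_def)
    moreover have "circ (x - y) * circ y = circ x" using circ_add[of "x - y" y] by simp
    ultimately have "circ (x - y) = 1" by (metis cmod_circ mult_cancel_right1 norm_zero zero_neq_one)
    then have "cos (2 * pi * (x - y)) = 1" by (simp add: circ_def complex_eq_iff)
    then obtain k :: int where "2 * pi * (x - y) = of_int k * (2 * pi)"
      using cos_one_2pi_int by (auto simp: mult_ac)
    then have "x - y = of_int k" by simp
    moreover from this have "k = 0 \<or> k = 1 \<or> k = -1" using that by auto
    ultimately show ?thesis using that by auto
  qed
  ultimately show "simple_path (phi \<circ> circ)"
    by (simp only: simple_path_def path_def loop_free_def) blast
  have "circ ` {0..1} = sphere 0 1"
  proof (intro equalityI subsetI)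
    fix z :: complex assume "z \<in> sphere 0 1"
    then have "cmod z = 1" by simp
    have "z = of_real (cmod z) * exp (\<i> * of_real (Arg2pi z))" using Arg2pi[of z] unfolding is_Arg_def by blast
    also have "\<dots> = cis (Arg2pi z)" by (simp add: cis_conv_exp \<open>cmod z = 1\<close>)
    finally obtain x where "0 \<le> x" "x < 2 * pi" "z = cis x" using Arg2pi[of z] by blast
    then show "z \<in> circ ` {0..1}" by (intro image_eqI[of _ _ "x / (2 * pi)"]) (auto simp: circ_def)
  qed auto
  then show "path_image (phi \<circ> circ) = frontier \<Omega>"
    by (simp only: path_image_def frontier_\<Omega> image_comp[symmetric])
  show "(phi \<circ> circ) (t + 1) = (phi \<circ> circ) t" for t
  proof -
    have "circ 1 = 1" by (simp add: circ_def)
    then show ?thesis by (simp add: circ_add)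
  qed
qed

section \<open>Failure of real analyticity at the point 1\<close>

lemma flat_at_1:
  "\<exists>C\<ge>0. \<forall>\<zeta>\<in>frontier \<Omega>. \<bar>(cmod \<zeta>)\<^sup>2 - 1\<bar> \<le> C * cmod (\<zeta> - 1) ^ N"
proof -
  obtain C where C: "0 \<le> C"
    "\<And>z. Re z < 1 \<or> z = 1 \<Longrightarrow> cmod (flat_ext (\<lambda>_. 1) z) \<le> C * cmod (1 - z) ^ N"
    using flat_ext_flat[OF tame_const] by blast
  \<comment> \<open>The modulus of \<open>phi z\<close> differs from 1 by at most the perturbation
    g, which is flat in |1 - z|; \<open>phi_expanding\<close> replaces |1 - z| by 2 |phi z - 1|. The
    3 bounds |phi z| + 1, as g \<le> 1.\<close>
  have "\<bar>(cmod (phi z))\<^sup>2 - 1\<bar> \<le> (3 * \<epsilon> * C * 2 ^ N) * cmod (phi z - 1) ^ N" if z: "cmod z = 1" for z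
  proof -
    define g where "g = cmod (\<epsilon> * flat_ext (\<lambda>_. 1) z)"
    have "g \<le> cmod (z - 1) / 2"
      using lip[of z 1] z by (simp add: g_def)
    then have "g \<le> 1" using z norm_triangle_ineq4[of z 1] by simp
    have d: "\<bar>cmod (phi z) - 1\<bar> \<le> g"
      using norm_triangle_ineq3[of "phi z" z] z by (simp add: phi_def g_def)
    have "\<bar>(cmod (phi z))\<^sup>2 - 1\<bar> = \<bar>cmod (phi z) - 1\<bar> * (cmod (phi z) + 1)"
    proof -
      have "(cmod (phi z))\<^sup>2 - 1 = (cmod (phi z) - 1) * (cmod (phi z) + 1)"
        by (simp add: power2_eq_square algebra_simps)
      moreover have "\<bar>cmod (phi z) + 1\<bar> = cmod (phi z) + 1" by (rule abs_of_nonneg) simp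
      ultimately show ?thesis by (simp only: abs_mult)
    qed
    also have "\<dots> \<le> g * 3" using d \<open>g \<le> 1\<close> by (intro mult_mono) (auto simp: g_def)
    also have "\<dots> \<le> \<epsilon> * (C * cmod (1 - z) ^ N) * 3"
      using C(2)[of z] Re_less_1_or_eq_1[of z] z eps_pos by (simp add: g_def norm_mult)
    also have "\<dots> \<le> \<epsilon> * (C * (2 * cmod (phi z - 1)) ^ N) * 3"
      using phi_expanding[of z 1] z eps_pos C(1)
      by (intro mult_right_mono mult_left_mono power_mono) (auto simp: norm_minus_commute)
    finally show ?thesis by (simp add: power_mult_distrib mult_ac)
  qed
  then show ?thesis using eps_pos C(1)
    by (intro exI[of _ "3 * \<epsilon> * C * 2 ^ N"]) (auto simp: frontier_\<Omega>)
qed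

text \<open>The chosen distances are those at which the imaginary part of \<open>tau z\<close> is a multiple of
  \<open>2 * pi\<close>, so that \<open>cosh (tau z)\<close> is a positive real number.\<close>

lemma cmod_phi_gt_1:
  assumes z: "cmod z = 1" and d: "cmod (1 - z) = 1 / (1 / 2 + 2 * (2 * pi * real k)\<^sup>2)" and k: "k > 0"
  shows "1 < cmod (phi z)"
proof -
  define s a b where "s = tau z" and "a = Re s" and "b = Im s"
  define m where "m = 2 * pi * real k"
  have "1 * 1 \<le> (2 * pi) * real k" using k pi_ge_two by (intro mult_mono) auto
  then have "1 \<le> m" by (simp add: m_def)
  then have "1 \<le> m\<^sup>2" by simp
  have nz: "z \<noteq> 1" 
  proof
    assume "z = 1"
    with d have "1 / 2 + 2 * m\<^sup>2 = 0" by (simp add: m_def)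
    then show False using zero_le_power2[of m] by linarith
  qed
  then have z1: "Re z < 1" using z Re_less_1_or_eq_1[of z] by auto
  have zz: "(Re z)\<^sup>2 + (Im z)\<^sup>2 = 1" using z by (simp add: cmod_power2[symmetric])
  have s2: "s ^ 2 = inverse (1 - z)" by (simp add: s_def tau_power2)
  \<comment> \<open>The circle is mapped by 1 / (1 - z) into the line of real part 1/2, which fixes
    a^2 - b^2; the prescribed distance fixes a^2 + b^2. Together they give b^2 = m^2.\<close>
  have "(1 - Re z)\<^sup>2 + (Im z)\<^sup>2 = 2 * (1 - Re z)" using zz by (simp add: power2_eq_square algebra_simps)
  then have "Re (s ^ 2) = 1 / 2" unfolding s2 using z1 by simp
  then have 1: "a\<^sup>2 - b\<^sup>2 = 1 / 2" by (simp add: a_def b_def power2_eq_square)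
  have "a\<^sup>2 + b\<^sup>2 = cmod (s ^ 2)" by (simp add: norm_power cmod_power2 a_def b_def)
  also have "\<dots> = 1 / 2 + 2 * m\<^sup>2" by (simp add: s2 norm_inverse d m_def)
  finally have "b\<^sup>2 = m\<^sup>2" using 1 by simp
  then have "b = m \<or> b = - m" by (simp add: power2_eq_iff)
  moreover have "cos m = 1" "sin m = 0"
    using cos_2npi[of k] sin_2npi[of k] by (simp_all add: m_def mult_ac)
  ultimately have "cos b = 1" "sin b = 0" by auto
  then have cosh: "cosh s = of_real (cosh a)"
    by (simp add: complex_eq_iff Re_cosh Im_cosh a_def b_def)
  define e where "e = \<epsilon> / cosh a"
  have "0 < e" using eps_pos by (simp add: e_def)
  have phi: "phi z = z + of_real e"
    using nz by (simp add: phi_def flat_ext_def s_def[symmetric] cosh e_def)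
  \<comment> \<open>Closeness to 1 puts z in Re z \<ge> 0, where adding the positive real e
    increases the modulus beyond 1.\<close>
  have "cmod (1 - z) \<le> 1" unfolding d m_def[symmetric] using \<open>1 \<le> m\<^sup>2\<close>
    by (simp add: divide_le_eq_1)
  then have "0 \<le> Re z" using complex_Re_le_cmod[of "1 - z"] by simp
  have "(cmod (phi z))\<^sup>2 = 1 + 2 * e * Re z + e\<^sup>2"
    using zz unfolding phi cmod_power2 by (simp add: power2_eq_square algebra_simps)
  also have "\<dots> > 1\<^sup>2" using \<open>0 < e\<close> \<open>0 \<le> Re z\<close> by (simp add: add_nonneg_pos)
  finally show ?thesis by (rule power2_less_imp_less) simp
qed

text \<open>An analytic \<open>\<gamma>\<close> would be unimodular near the parameter of 1. It
  moves away from 1 continuously, so by the intermediate value theorem it meets a point covered by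
  \<open>cmod_phi_gt_1\<close>.\<close>

lemma not_real_analytic: "\<not> real_analytic_jordan_curve (frontier \<Omega>)"
proof
  assume "real_analytic_jordan_curve (frontier \<Omega>)"
  then obtain \<gamma> where \<gamma>: "regular_jordan_param \<gamma> (frontier \<Omega>)" "real_analytic_param \<gamma>"
    by (auto simp: real_analytic_jordan_curve_def)
  have in_fr: "\<gamma> t \<in> phi ` sphere 0 1" for t
    using regular_jordan_param_in[OF \<gamma>(1)] by (simp add: frontier_\<Omega>)
  have "1 \<in> frontier \<Omega>" unfolding frontier_\<Omega> by (intro image_eqI[of _ _ 1]) auto
  then obtain t where t: "\<gamma> t = 1"
    using \<gamma>(1) unfolding regular_jordan_param_def path_image_def by (metis imageE)
  have diff: "\<gamma> differentiable (at t)" for t using \<gamma>(1) by (simp add: regular_jordan_param_def)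
  define D where "D = vector_derivative \<gamma> (at t)"
  have D: "(\<gamma> has_vector_derivative D) (at t)" "D \<noteq> 0"
    using \<gamma>(1) by (auto simp: D_def regular_jordan_param_def vector_derivative_works)
  obtain r\<^sub>0 a where r0: "0 < r\<^sub>0" "\<And>s. \<bar>s - t\<bar> < r\<^sub>0 \<Longrightarrow> (\<lambda>n. a n * of_real (s - t) ^ n) sums \<gamma> s"
    using \<gamma>(2) unfolding real_analytic_param_def by blast
  \<comment> \<open>Differentiability bounds |\<gamma> s - 1| linearly in |s - t|, which turns
    flatness in the distance to 1 into flatness in the parameter.\<close>
  obtain r\<^sub>1 where r1: "0 < r\<^sub>1" "\<And>s. \<bar>s - t\<bar> < r\<^sub>1 \<Longrightarrow> cmod (\<gamma> s - 1) \<le> (cmod D + 1) * \<bar>s - t\<bar>"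
  proof -
    obtain d where d: "0 < d" "\<And>s. \<bar>s - t\<bar> < d \<Longrightarrow> cmod (\<gamma> s - \<gamma> t - (s - t) *\<^sub>R D) \<le> 1 * \<bar>s - t\<bar>"
    proof -
      have "\<forall>e>0. \<exists>d>0. \<forall>s. norm (s - t) < d \<longrightarrow>
          norm (\<gamma> s - \<gamma> t - (s - t) *\<^sub>R D) \<le> e * norm (s - t)"
        using D(1) unfolding has_vector_derivative_def has_derivative_at_alt by blast
      then have "\<exists>d>0. \<forall>s. norm (s - t) < d \<longrightarrow>
          norm (\<gamma> s - \<gamma> t - (s - t) *\<^sub>R D) \<le> 1 * norm (s - t)"
        using zero_less_one by blast
      with that show ?thesis by auto
    qed
    have "cmod (\<gamma> s - 1) \<le> (cmod D + 1) * \<bar>s - t\<bar>" if "\<bar>s - t\<bar> < d" for s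
    proof -
      have "cmod (\<gamma> s - 1) \<le> cmod (\<gamma> s - \<gamma> t - (s - t) *\<^sub>R D) + cmod ((s - t) *\<^sub>R D)"
        using norm_triangle_ineq[of "\<gamma> s - \<gamma> t - (s - t) *\<^sub>R D" "(s - t) *\<^sub>R D"] by (simp add: t)
      also have "\<dots> \<le> \<bar>s - t\<bar> + \<bar>s - t\<bar> * cmod D" using d(2)[OF that] by simp
      finally show ?thesis by (simp add: algebra_simps)
    qed
    then show ?thesis using that d(1) by blast
  qed
  define r where "r = min r\<^sub>0 r\<^sub>1"
  have "0 < r" using r0(1) r1(1) by (simp add: r_def)
  have unimodular: "cmod (\<gamma> s) = 1" if "\<bar>s - t\<bar> < r" for s
  proof (rule real_analytic_unimodular_if_flat[OF _ _ that])
    show "(\<lambda>n. a n * of_real (s - t) ^ n) sums \<gamma> s" if "\<bar>s - t\<bar> < r" for s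
      using that by (intro r0) (simp add: r_def)
    fix N
    obtain C where C: "0 \<le> C" "\<And>\<zeta>. \<zeta> \<in> frontier \<Omega> \<Longrightarrow> \<bar>(cmod \<zeta>)\<^sup>2 - 1\<bar> \<le> C * cmod (\<zeta> - 1) ^ N"
      using flat_at_1 by blast
    have "\<bar>(cmod (\<gamma> s))\<^sup>2 - 1\<bar> \<le> (C * (cmod D + 1) ^ N) * \<bar>s - t\<bar> ^ N" if "\<bar>s - t\<bar> < r" for s
    proof -
      have "\<bar>(cmod (\<gamma> s))\<^sup>2 - 1\<bar> \<le> C * cmod (\<gamma> s - 1) ^ N"
        by (rule C(2)) (rule regular_jordan_param_in[OF \<gamma>(1)])
      also have "\<dots> \<le> C * ((cmod D + 1) * \<bar>s - t\<bar>) ^ N"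
        using C(1) r1(2)[of s] that by (intro mult_left_mono power_mono) (auto simp: r_def)
      finally show ?thesis by (simp add: power_mult_distrib)
    qed
    then show "\<exists>C. \<forall>s. \<bar>s - t\<bar> < r \<longrightarrow> \<bar>(cmod (\<gamma> s))\<^sup>2 - 1\<bar> \<le> C * \<bar>s - t\<bar> ^ N" by blast
  qed
  \<comment> \<open>The nonzero derivative at \<open>t\<close> prevents \<open>\<gamma>\<close> from
    being constant nearby.\<close>
  obtain s\<^sub>1 where s1: "\<bar>s\<^sub>1 - t\<bar> < r" "\<gamma> s\<^sub>1 \<noteq> 1"
  proof (rule ccontr)
    assume "\<not> thesis"
    then have c: "\<And>s. s \<in> ball t r \<Longrightarrow> 1 = \<gamma> s" using that by (auto simp: dist_real_def abs_minus_commute)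
    have "(\<gamma> has_vector_derivative 0) (at t)"
      by (rule has_vector_derivative_transform_within_open[OF has_vector_derivative_const open_ball _ c])
        (use \<open>0 < r\<close> in auto)
    then show False using D vector_derivative_unique_at by blast
  qed
  \<comment> \<open>Distance to 1 after pulling back to the circle, the quantity prescribed in
    \<open>cmod_phi_gt_1\<close>.\<close>
  define d where "d s = cmod (1 - psi (\<gamma> s))" for s
  have cont: "continuous_on (ball t r) d"
  proof -
    have "continuous_on (ball t r) \<gamma>"
      using diff by (auto intro!: continuous_at_imp_continuous_on differentiable_imp_continuous_within)
    moreover have "\<gamma> ` ball t r \<subseteq> phi ` cball 0 1" using in_fr by fastforce
    ultimately have "continuous_on (ball t r) (\<lambda>s. psi (\<gamma> s))"
      by (rule continuous_on_compose2[OF continuous_on_psi])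
    then show ?thesis unfolding d_def by (intro continuous_intros)
  qed
  have psi_in: "cmod (psi (\<gamma> s)) = 1" "phi (psi (\<gamma> s)) = \<gamma> s" for s
    using in_fr[of s] by auto
  have "d t = 0" using psi_phi[of 1] by (simp add: d_def t)
  have "0 < d s\<^sub>1" using psi_in(2)[of s\<^sub>1] s1(2) by (auto simp: d_def)
  \<comment> \<open>With k this large the special distance \<delta> is at most 1/k, hence lies
    between d t = 0 and the value of d at the second parameter.\<close>
  obtain k :: nat where k: "inverse (d s\<^sub>1) < real k" using reals_Archimedean2 by blast
  then have "0 < real k" using \<open>0 < d s\<^sub>1\<close> by (meson inverse_positive_iff_positive order_less_trans)
  then have "0 < k" by simp
  define \<delta> where "\<delta> = 1 / (1 / 2 + 2 * (2 * pi * real k)\<^sup>2)"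
  have "real k \<le> 1 / 2 + 2 * (2 * pi * real k)\<^sup>2"
  proof -
    have "1 * real k \<le> (2 * pi) * real k" using pi_ge_two by (intro mult_right_mono) auto
    moreover have "1 \<le> real k" using \<open>0 < k\<close> by simp
    ultimately have "1 \<le> 2 * pi * real k" "real k \<le> 2 * pi * real k" by linarith+
    then have "real k \<le> (2 * pi * real k)\<^sup>2" by (meson order_trans self_le_power zero_less_numeral)
    then show ?thesis by linarith
  qed
  then have "\<delta> \<le> inverse (real k)" using \<open>0 < k\<close> by (simp add: \<delta>_def divide_simps)
  also have "\<dots> \<le> d s\<^sub>1" using k \<open>0 < d s\<^sub>1\<close> \<open>0 < real k\<close> by (simp add: field_simps)
  finally have "\<delta> \<le> d s\<^sub>1" .
  moreover have "0 \<le> \<delta>" by (simp add: \<delta>_def)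
  moreover have "connected (d ` ball t r)" by (rule connected_continuous_image[OF cont connected_ball])
  moreover have "d t \<in> d ` ball t r" "d s\<^sub>1 \<in> d ` ball t r"
    using s1(1) \<open>0 < r\<close> by (auto simp: dist_real_def abs_minus_commute)
  ultimately have "\<delta> \<in> d ` ball t r"
    using connected_contains_Icc[of "d ` ball t r" "d t" "d s\<^sub>1"] \<open>d t = 0\<close> by auto
  then obtain s where s: "s \<in> ball t r" "d s = \<delta>" by auto
  then have "1 < cmod (phi (psi (\<gamma> s)))"
    using \<open>0 < k\<close> by (intro cmod_phi_gt_1[of _ k] psi_in) (auto simp: d_def \<delta>_def)
  moreover have "cmod (\<gamma> s) = 1"
    using s(1) by (intro unimodular) (simp add: dist_real_def abs_minus_commute)
  ultimately show False by (simp add: psi_in)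
qed

end

section \<open>Choice of \<open>\<epsilon>\<close> and conclusion\<close>

lemma flat_perturbation_exists: "\<exists>\<epsilon>. flat_perturbation \<epsilon>"
proof -
  obtain B where B: "0 \<le> B" "\<And>x y. Re x < 1 \<or> x = 1 \<Longrightarrow> Re y < 1 \<or> y = 1 \<Longrightarrow>
    cmod (flat_ext (\<lambda>_. 1) x - flat_ext (\<lambda>_. 1) y) \<le> B * cmod (x - y)"
    using flat_ext_lipschitz[OF tame_const[of 1]] by blast
  obtain q where q: "tame q"
    "\<And>t. ((\<lambda>t. flat_ext (\<lambda>_. 1) (circ t)) has_vector_derivative flat_ext q (circ t)) (at t)"
    using flat_ext_circ_derivative[OF tame_const[of 1]] by blast
  obtain C where C: "0 \<le> C" "\<And>z. Re z < 1 \<or> z = 1 \<Longrightarrow> cmod (flat_ext q z) \<le> C"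
    using flat_ext_flat[OF q(1), of 0] by auto
  \<comment> \<open>B is the Lipschitz constant and C bounds the derivative along the circle; both
    products with \<open>\<epsilon>\<close> are at most 1/2, and 1/2 < 2 pi.\<close>
  define \<epsilon> where "\<epsilon> = 1 / (2 * (1 + B + C))"
  have eps: "0 < \<epsilon>" "\<epsilon> * B \<le> 1 / 2" "\<epsilon> * C \<le> 1 / 2"
    using B(1) C(1) by (auto simp: \<epsilon>_def field_simps)
  have "flat_perturbation \<epsilon>"
  proof
    show "cmod (\<epsilon> * flat_ext (\<lambda>_. 1) x - \<epsilon> * flat_ext (\<lambda>_. 1) y) \<le> cmod (x - y) / 2"
      if "x \<in> cball 0 1" "y \<in> cball 0 1" for x y
    proof -
      have "cmod (\<epsilon> * flat_ext (\<lambda>_. 1) x - \<epsilon> * flat_ext (\<lambda>_. 1) y)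
          = \<epsilon> * cmod (flat_ext (\<lambda>_. 1) x - flat_ext (\<lambda>_. 1) y)"
        using eps(1) by (simp add: right_diff_distrib[symmetric] norm_mult)
      also have "\<dots> \<le> \<epsilon> * (B * cmod (x - y))"
        using that eps(1) by (intro mult_left_mono B Re_less_1_or_eq_1) auto
      also have "\<dots> = (\<epsilon> * B) * cmod (x - y)" by simp
      also have "\<dots> \<le> (1 / 2) * cmod (x - y)" using eps by (intro mult_right_mono) auto
      finally show ?thesis by simp
    qed
    show "\<exists>D. ((\<lambda>t. flat_ext (\<lambda>_. 1) (circ t)) has_vector_derivative D) (at t) \<and> \<epsilon> * cmod D < 2 * pi" for t
    proof (intro exI conjI)
      show "((\<lambda>t. flat_ext (\<lambda>_. 1) (circ t)) has_vector_derivative flat_ext q (circ t)) (at t)" by (rule q)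
      have "\<epsilon> * cmod (flat_ext q (circ t)) \<le> \<epsilon> * C"
        using eps(1) by (intro mult_left_mono C Re_less_1_or_eq_1) auto
      then show "\<epsilon> * cmod (flat_ext q (circ t)) < 2 * pi" using eps(3) pi_ge_two by linarith
    qed
  qed (rule eps)
  then show ?thesis ..
qed

theorem mainTheorem3:
  "\<exists>(\<Omega> :: complex set) (f1 :: complex \<Rightarrow> complex) (f2 :: complex \<Rightarrow> complex).
     \<Omega> \<noteq> {} \<and> open \<Omega> \<and> connected \<Omega> \<and> bounded \<Omega> \<and> simply_connected \<Omega> \<and>
     f1 holomorphic_on \<Omega> \<and> continuous_on (closure \<Omega>) f1 \<and>
     f2 holomorphic_on \<Omega> \<and> continuous_on (closure \<Omega>) f2 \<and>
     (\<exists>z\<in>\<Omega>. f2 z \<noteq> 0) \<and>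
     (\<forall>\<zeta>\<in>frontier \<Omega>. f1 \<zeta> = cnj \<zeta> * f2 \<zeta>) \<and>
     smooth_jordan_curve (frontier \<Omega>) \<and>
     \<not> real_analytic_jordan_curve (frontier \<Omega>)"
proof -
  obtain \<epsilon> where "flat_perturbation \<epsilon>" using flat_perturbation_exists by blast
  then interpret flat_perturbation \<epsilon> .
  \<comment> \<open>Functions on the disc are transported to the domain by \<open>psi\<close>, which
    is holomorphic inside and continuous up to the boundary.\<close>
  have hol: "(g \<circ> psi) holomorphic_on \<Omega>" if "g holomorphic_on {z. Re z < 1}" for g
    using holomorphic_psi that by (rule holomorphic_on_compose_gen) (use ball_subset_halfplane in auto)
  have cont: "continuous_on (closure \<Omega>) (g \<circ> psi)" if "continuous_on (cball 0 1) g" for g :: "complex \<Rightarrow> complex"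
    unfolding closure_\<Omega> by (intro continuous_on_compose continuous_on_psi continuous_on_subset[OF that]) auto
  show ?thesis
  proof (intro exI conjI)
    show "\<Omega> \<noteq> {}" by simp
    show "\<exists>z\<in>\<Omega>. (G2 \<circ> psi) z \<noteq> 0"
      using G2_nonzero by (intro bexI[of _ "phi (- 1 / 2)"]) auto
    show "\<forall>\<zeta>\<in>frontier \<Omega>. (G1 \<circ> psi) \<zeta> = cnj \<zeta> * (G2 \<circ> psi) \<zeta>"
      by (auto simp: frontier_\<Omega> G1_eq_cnj_phi_G2)
    show "smooth_jordan_curve (frontier \<Omega>)"
      unfolding smooth_jordan_curve_def using regular_jordan_phi_circ smooth_param_phi_circ by blast
  qed (fact open_\<Omega> connected_\<Omega> bounded_\<Omega> simply_connected_\<Omega> not_real_analytic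
    hol[OF holomorphic_G1] hol[OF holomorphic_G2] cont[OF continuous_on_G1] cont[OF continuous_on_G2])+
qed

end
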